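(* $\gamma_{10}(K_1)=\frac{3}{5}$.
   Context: $K_1=\{(x_1,x_2,x_3)\in\mathbb{R}^3: |x_1|+|x_2|+|x_3|\le 1\}$ is the unit crosspolytope in three-dimensional Euclidean space $\mathbb{E}^3$. For a convex body (compact convex set with non-empty interior) $K\subset\mathbb{E}^n$ and a positive integer $m$, $\gamma_m(K)$ denotes the smallest positive number $\lambda$ such that $K$ can be covered by $m$ translates of $\lambda K$: $$\gamma_m(K)=\min\Big\{\lambda>0:\ \exists\,\boldsymbol u_1,\dots,\boldsymbol u_m\in\mathbb{E}^n \text{ such that } K\subseteq\bigcup_{i=1}^m(\lambda K+\boldsymbol u_i)\Big\}.$$ *)

theory Defs
  imports "HOL-Analysis.Analysis"
begin

definition covered_by_translates :: "nat \<Rightarrow> real \<Rightarrow> 'a::euclidean_space set \<Rightarrow> bool" where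
  "covered_by_translates m l K \<longleftrightarrow>
     (\<exists>u :: nat \<Rightarrow> 'a. K \<subseteq> (\<Union>i\<in>{1..m}. (+) (u i) ` ((*\<^sub>R) l ` K)))"

(* Intended for a convex body K (compact, convex, non-empty interior) and m > 0, where the
   minimum is attained by compactness.  LEAST returns the minimum only if it is attained;
   unlike an infimum, its value is otherwise unspecified. *)
definition covering_functional :: "nat \<Rightarrow> 'a::euclidean_space set \<Rightarrow> real" where
  "covering_functional m K = (LEAST l. l > 0 \<and> covered_by_translates m l K)"

definition crosspolytope3 :: "(real ^ 3) set" where
  "crosspolytope3 = {x. \<bar>x $ 1\<bar> + \<bar>x $ 2\<bar> + \<bar>x $ 3\<bar> \<le> 1}"

end

theory Submission
  imports Defs
begin

text \<open>
  The crosspolytope is the unit ball of the \<open>\<ell>\<^sub>1\<close> norm, so the question is how small ten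
  \<open>\<ell>\<^sub>1\<close> balls of equal radius may be and still cover the unit ball.

  Radius \<open>3/5\<close> is necessary because the crosspolytope contains eleven points whose mutual
  \<open>\<ell>\<^sub>1\<close> distances are at least \<open>6/5\<close> (\<open>separated_points\<close>): of ten smaller balls covering it, one
  would contain two of these points, although its diameter is below \<open>6/5\<close>.
  The eleven points are the six vertices and five further points of the boundary.  A boundary
  point has distance at least \<open>6/5\<close> from all vertices iff its coordinates are at most \<open>2/5\<close> in
  modulus, which leaves one small triangle on each facet, whose corners are the permutations of
  \<open>(2/5, 2/5, 1/5)\<close> with signs.  The five points are corners of triangles on five facets.

  Radius \<open>3/5\<close> suffices (\<open>covering_centres\<close>).  Centre six balls at the points at distance \<open>2/5\<close>
  from the origin on the coordinate axes.  What they miss lies, in the octant of nonnegative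
  coordinates, in the tetrahedron with vertices \<open>(1/5, 1/5, 1/5)\<close> and the permutations of
  \<open>(2/5, 2/5, 1/5)\<close>, and symmetrically in the other octants.  The two tetrahedra on either side of
  the plane \<open>x\<^sub>3 = 0\<close> over a common quadrant fit into one ball, centred at
  \<open>(\<plusminus>3/10, \<plusminus>3/10, 0)\<close>; there are four such pairs.
\<close>

definition l1_norm :: "real ^ 3 \<Rightarrow> real" where
  "l1_norm x = \<bar>x $ 1\<bar> + \<bar>x $ 2\<bar> + \<bar>x $ 3\<bar>"

lemma crosspolytope3_iff: "x \<in> crosspolytope3 \<longleftrightarrow> l1_norm x \<le> 1"
  by (simp add: crosspolytope3_def l1_norm_def)

lemma l1_norm_scaleR: "l1_norm (c *\<^sub>R x) = \<bar>c\<bar> * l1_norm x"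
  by (simp add: l1_norm_def abs_mult algebra_simps)

lemma l1_norm_diff_triangle: "l1_norm (p - q) \<le> l1_norm (p - c) + l1_norm (q - c)"
proof -
  have "\<bar>p $ i - q $ i\<bar> \<le> \<bar>p $ i - c $ i\<bar> + \<bar>q $ i - c $ i\<bar>" for i
    by linarith
  then have "l1_norm (p - q) \<le> (\<bar>p $ 1 - c $ 1\<bar> + \<bar>q $ 1 - c $ 1\<bar>) +
      (\<bar>p $ 2 - c $ 2\<bar> + \<bar>q $ 2 - c $ 2\<bar>) + (\<bar>p $ 3 - c $ 3\<bar> + \<bar>q $ 3 - c $ 3\<bar>)"
    unfolding l1_norm_def vector_minus_component by (intro add_mono)
  also have "\<dots> = l1_norm (p - c) + l1_norm (q - c)"
    by (simp add: l1_norm_def)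
  finally show ?thesis .
qed

lemma l1_norm_vector_diff:
  "l1_norm (vector [a, b, c] - vector [a', b', c']) = \<bar>a - a'\<bar> + \<bar>b - b'\<bar> + \<bar>c - c'\<bar>"
  by (simp add: l1_norm_def vector_3)

lemma translate_crosspolytope3_iff:
  assumes "l > 0"
  shows "x \<in> (+) c ` ((*\<^sub>R) l ` crosspolytope3) \<longleftrightarrow> l1_norm (x - c) \<le> l"
proof
  assume "x \<in> (+) c ` ((*\<^sub>R) l ` crosspolytope3)"
  then obtain k where "k \<in> crosspolytope3" "x = c + l *\<^sub>R k" by auto
  then show "l1_norm (x - c) \<le> l"
    using assms by (simp add: crosspolytope3_iff l1_norm_scaleR)
next
  assume le: "l1_norm (x - c) \<le> l"
  define k where "k = (1 / l) *\<^sub>R (x - c)"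
  have "k \<in> crosspolytope3"
    using assms le by (simp add: k_def crosspolytope3_iff l1_norm_scaleR)
  moreover have "x = c + l *\<^sub>R k"
    using assms by (simp add: k_def)
  ultimately show "x \<in> (+) c ` ((*\<^sub>R) l ` crosspolytope3)" by blast
qed

section \<open>Separated points bound the radius from below\<close>

text \<open>The pigeonhole principle: two of more than \<open>m\<close> points share one of \<open>m\<close> balls, and a ball of
  radius \<open>l\<close> has diameter \<open>2 * l\<close>.\<close>

lemma separation_le_twice_radius:
  assumes cov: "covered_by_translates m l crosspolytope3" and l: "l > 0"
    and sub: "set ps \<subseteq> crosspolytope3" and len: "m < length ps"
    and sep: "sorted_wrt (\<lambda>p q. d \<le> l1_norm (p - q)) ps"
  shows "d \<le> 2 * l"
proof -
  obtain u where u: "crosspolytope3 \<subseteq> (\<Union>i\<in>{1..m}. (+) (u i) ` ((*\<^sub>R) l ` crosspolytope3))"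
    using cov unfolding covered_by_translates_def by blast
  have "\<exists>i\<in>{1..m}. l1_norm (ps ! k - u i) \<le> l" if "k < length ps" for k
  proof -
    have "ps ! k \<in> crosspolytope3"
      using sub nth_mem[OF that] by blast
    with u have "\<exists>i\<in>{1..m}. ps ! k \<in> (+) (u i) ` ((*\<^sub>R) l ` crosspolytope3)" by blast
    then show ?thesis
      by (simp only: translate_crosspolytope3_iff[OF l])
  qed
  then obtain f where f: "\<And>k. k < length ps \<Longrightarrow> f k \<in> {1..m} \<and> l1_norm (ps ! k - u (f k)) \<le> l"
    by metis
  have "card (f ` {..<length ps}) \<le> card {1..m}"
    using f by (intro card_mono) auto
  then have "\<not> inj_on f {..<length ps}"
    using len by (intro pigeonhole) simp
  then obtain a b where ab: "a < b" "b < length ps" "f a = f b"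
    unfolding inj_on_def by (metis lessThan_iff linorder_neq_iff)
  have "d \<le> l1_norm (ps ! a - ps ! b)"
    using sorted_wrt_nth_less[OF sep] ab by simp
  also have "\<dots> \<le> l1_norm (ps ! a - u (f a)) + l1_norm (ps ! b - u (f a))"
    by (rule l1_norm_diff_triangle)
  also have "\<dots> \<le> 2 * l"
    using f[of a] f[of b] ab by simp
  finally show ?thesis .
qed

text \<open>The six vertices are followed by five corners of the facet triangles that lie at distance at
  least \<open>6/5\<close> from all vertices.  Corners on facets sharing an edge are at distance \<open>6/5\<close> only
  if the coordinate changing sign has modulus \<open>2/5\<close> in both and the other two moduli are
  interchanged.  A facet can therefore have at most two of its three neighbours in use, so four
  facets without common edges admit no fifth; instead, five facets are used that form a path,
  in which each is adjacent to the next: the one of the tenth point, then those of the eighth,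
  the seventh, the ninth and the last.\<close>

definition separated_points :: "(real ^ 3) list" where
  "separated_points =
     [vector [1, 0, 0], vector [-1, 0, 0],
      vector [0, 1, 0], vector [0, -1, 0],
      vector [0, 0, 1], vector [0, 0, -1],
      vector [2/5, 2/5, 1/5],
      vector [-2/5, 1/5, 2/5],
      vector [1/5, -2/5, 2/5],
      vector [-1/5, 2/5, -2/5],
      vector [2/5, -1/5, -2/5]]"

lemma separated_points_subset: "set separated_points \<subseteq> crosspolytope3"
  by (simp add: separated_points_def crosspolytope3_def vector_3)

lemma separated_points_separated:
  "sorted_wrt (\<lambda>p q. 6/5 \<le> l1_norm (p - q)) separated_points"
  unfolding separated_points_def sorted_wrt.simps list.set ball_simps l1_norm_vector_diff
  by simp

section \<open>A covering by ten balls of radius three fifths\<close>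

lemma covered_by_translates_crosspolytope3I:
  assumes l: "l > 0"
    and near: "\<And>x. x \<in> crosspolytope3 \<Longrightarrow> \<exists>c\<in>set cs. l1_norm (x - c) \<le> l"
  shows "covered_by_translates (length cs) l crosspolytope3"
  unfolding covered_by_translates_def
proof (intro exI subsetI)
  fix x :: "real ^ 3"
  assume "x \<in> crosspolytope3"
  then obtain k where k: "k < length cs" "l1_norm (x - cs ! k) \<le> l"
    using near by (metis in_set_conv_nth)
  then have "Suc k \<in> {1..length cs}" "x \<in> (+) (cs ! (Suc k - 1)) ` ((*\<^sub>R) l ` crosspolytope3)"
    by (simp, simp only: translate_crosspolytope3_iff[OF l] diff_Suc_1)
  then show "x \<in> (\<Union>i\<in>{1..length cs}. (+) (cs ! (i - 1)) ` ((*\<^sub>R) l ` crosspolytope3))"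
    by blast
qed

definition covering_centres :: "(real ^ 3) list" where
  "covering_centres =
     [vector [2/5, 0, 0], vector [-2/5, 0, 0],
      vector [0, 2/5, 0], vector [0, -2/5, 0],
      vector [0, 0, 2/5], vector [0, 0, -2/5],
      vector [3/10, 3/10, 0], vector [3/10, -3/10, 0],
      vector [-3/10, 3/10, 0], vector [-3/10, -3/10, 0]]"

text \<open>The covering inside one octant.  Failure of the first three inequalities keeps each of \<open>a\<close>,
  \<open>b\<close>, \<open>c\<close> below \<open>2/5\<close> and makes the sum of any two exceed the third by more than \<open>1/5\<close>; adding
  two of these, each of \<open>a\<close>, \<open>b\<close>, \<open>c\<close> is above \<open>1/5\<close>, and the last inequality follows.\<close>

lemma octant_covering:
  fixes a b c :: real
  assumes "a \<ge> 0" "b \<ge> 0" "c \<ge> 0" "a + b + c \<le> 1"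
  shows "\<bar>a - 2/5\<bar> + b + c \<le> 3/5 \<or> a + \<bar>b - 2/5\<bar> + c \<le> 3/5 \<or> a + b + \<bar>c - 2/5\<bar> \<le> 3/5 \<or>
    \<bar>a - 3/10\<bar> + \<bar>b - 3/10\<bar> + c \<le> 3/5"
proof (rule ccontr)
  assume "\<not> ?thesis"
  then have far: "\<bar>a - 2/5\<bar> + b + c > 3/5" "a + \<bar>b - 2/5\<bar> + c > 3/5" "a + b + \<bar>c - 2/5\<bar> > 3/5"
    and far': "\<bar>a - 3/10\<bar> + \<bar>b - 3/10\<bar> + c > 3/5"
    by (simp_all add: not_le)
  have "b + c - a > 1/5" "a + c - b > 1/5" "a + b - c > 1/5"
    using far assms by linarith+
  then show False
    using far' assms by linarith
qed

lemma covering_centres_near: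
  assumes "x \<in> crosspolytope3"
  shows "\<exists>c\<in>set covering_centres. l1_norm (x - c) \<le> 3/5"
proof -
  \<comment> \<open>The set of centres is symmetric in each coordinate, so the coordinates of \<open>x\<close> may be replaced
    by their moduli if the centre takes over the signs.\<close>
  define s :: "real \<Rightarrow> real" where "s t = (if t < 0 then -1 else 1)" for t
  have s: "\<bar>t - s t * r\<bar> = \<bar>\<bar>t\<bar> - r\<bar>" for t r
    by (auto simp: s_def)
  have "\<bar>x $ 1\<bar> + \<bar>x $ 2\<bar> + \<bar>x $ 3\<bar> \<le> 1"
    using assms by (simp add: crosspolytope3_def)
  from octant_covering[OF abs_ge_zero abs_ge_zero abs_ge_zero this]
  consider "\<bar>\<bar>x $ 1\<bar> - 2/5\<bar> + \<bar>x $ 2\<bar> + \<bar>x $ 3\<bar> \<le> 3/5"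
    | "\<bar>x $ 1\<bar> + \<bar>\<bar>x $ 2\<bar> - 2/5\<bar> + \<bar>x $ 3\<bar> \<le> 3/5"
    | "\<bar>x $ 1\<bar> + \<bar>x $ 2\<bar> + \<bar>\<bar>x $ 3\<bar> - 2/5\<bar> \<le> 3/5"
    | "\<bar>\<bar>x $ 1\<bar> - 3/10\<bar> + \<bar>\<bar>x $ 2\<bar> - 3/10\<bar> + \<bar>x $ 3\<bar> \<le> 3/5"
    by blast
  then show ?thesis
  proof cases
    case 1
    show ?thesis
    proof (rule bexI)
      show "l1_norm (x - vector [s (x $ 1) * (2/5), 0, 0]) \<le> 3/5"
        using 1 by (simp only: l1_norm_def vector_minus_component vector_3 diff_zero s)
      show "vector [s (x $ 1) * (2/5), 0, 0] \<in> set covering_centres"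
        by (simp add: covering_centres_def s_def)
    qed
  next
    case 2
    show ?thesis
    proof (rule bexI)
      show "l1_norm (x - vector [0, s (x $ 2) * (2/5), 0]) \<le> 3/5"
        using 2 by (simp only: l1_norm_def vector_minus_component vector_3 diff_zero s)
      show "vector [0, s (x $ 2) * (2/5), 0] \<in> set covering_centres"
        by (simp add: covering_centres_def s_def)
    qed
  next
    case 3
    show ?thesis
    proof (rule bexI)
      show "l1_norm (x - vector [0, 0, s (x $ 3) * (2/5)]) \<le> 3/5"
        using 3 by (simp only: l1_norm_def vector_minus_component vector_3 diff_zero s)
      show "vector [0, 0, s (x $ 3) * (2/5)] \<in> set covering_centres"
        by (simp add: covering_centres_def s_def)
    qed
  next
    case 4
    show ?thesis
    proof (rule bexI)
      show "l1_norm (x - vector [s (x $ 1) * (3/10), s (x $ 2) * (3/10), 0]) \<le> 3/5"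
        using 4 by (simp only: l1_norm_def vector_minus_component vector_3 diff_zero s)
      show "vector [s (x $ 1) * (3/10), s (x $ 2) * (3/10), 0] \<in> set covering_centres"
        by (simp add: covering_centres_def s_def)
    qed
  qed
qed

section \<open>The covering functional\<close>

theorem theorem1p4:
  shows "covering_functional 10 crosspolytope3 = 3 / 5"
  unfolding covering_functional_def
proof (rule Least_equality)
  have "length covering_centres = 10"
    by (simp add: covering_centres_def)
  then show "(3 / 5 :: real) > 0 \<and> covered_by_translates 10 (3 / 5) crosspolytope3"
    using covered_by_translates_crosspolytope3I[OF _ covering_centres_near] by simp
next
  fix l :: real
  assume l: "l > 0 \<and> covered_by_translates 10 l crosspolytope3"
  have "10 < length separated_points"
    by (simp add: separated_points_def)
  then have "6 / 5 \<le> 2 * l"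
    using l by (intro separation_le_twice_radius[OF _ _ separated_points_subset _
        separated_points_separated]) auto
  then show "3 / 5 \<le> l" by simp
qed

end
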